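(* Let $\tau$ be the Tribonacci constant, i.e. the largest real root of $x^3-x^2-x-1$. Let $N\ge 1$ be an integer and let $(x_h)_{h\ge0}$ be the canonical Tribonacci expansion of $N$. Then $$\lambda_{N+k}(\tau)-\lambda_k(\tau)\ \ge\ N\gamma_{3,N}\qquad\text{for all } k\ge 1,$$ where $$\gamma_{3,N}:=\frac1N\left(\sum_{h=0}^\infty x_h\tau^h-2(\tau^2-1)\right),$$ and this constant satisfies $$\gamma_{3,N}\ \ge\ \frac1{C_1\tau^3}-\frac1N\left(\frac1{2C_1\tau^3}\log_\tau\left(\frac{N+\frac12}{C_1}\right)+2\tau^2-2-\frac1{C_1\tau^3}\right),$$ where $C_1:=\dfrac{1}{3\tau^2-2\tau-1}\approx 0.18$. Moreover, for $N=2$ the estimate is sharpened: the inequality $\lambda_{2+k}(\tau)-\lambda_k(\tau)\ge 2\gamma_{3,2}$ for all $k\ge 1$ also holds with $\gamma_{3,2}=\frac{\tau^2-\tau}{2}$.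
   Context: The spectrum of $\tau$ is $\Lambda(\tau):=\left\{\sum_{i=0}^n\varepsilon_i\tau^i\mid \varepsilon_i\in\{0,1\},\ n=0,1,\dots\right\}$. Its elements are listed in strictly increasing order as $\Lambda(\tau)=\{0<\lambda_1(\tau)<\lambda_2(\tau)<\cdots\}$. The (shifted) Tribonacci sequence is $T_0=1$, $T_1=2$, $T_2=4$, $T_n=T_{n-1}+T_{n-2}+T_{n-3}$ for $n\ge 3$. The canonical Tribonacci expansion of $N$ is the binary sequence $(x_h)_{h\ge0}\in\{0,1\}^\infty$ with only finitely many nonzero terms, containing no block of three consecutive $1$'s, such that $N=\sum_{h\ge0}x_hT_h$. It is produced by the greedy algorithm, which repeatedly subtracts the largest $T_h$ not exceeding the current remainder. *)

theory Defs
  imports Complex_Main "HOL-Library.Infinite_Set" "HOL-Computational_Algebra.Polynomial"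
begin

definition pow_spectrum :: "real \<Rightarrow> real set" where
  "pow_spectrum q = {(\<Sum>i\<le>n. \<epsilon> i * q ^ i) | n \<epsilon>. \<forall>i\<le>n. \<epsilon> i \<in> {0, 1}}"

(* The indexing starts with 0 as element number 0. The enumeration exists and is unique for q > 1,
   see ex1_spectrum_listing below. *)
definition spectrum_listing :: "real \<Rightarrow> nat \<Rightarrow> real" where
  "spectrum_listing q = (THE l. strict_mono l \<and> range l = pow_spectrum q)"

definition tribonacci_const :: real where
  "tribonacci_const = Max {x. x ^ 3 - x ^ 2 - x - 1 = 0}"

fun trib :: "nat \<Rightarrow> nat" where
  "trib 0 = 1"
| "trib (Suc 0) = 2"
| "trib (Suc (Suc 0)) = 4"
| "trib (Suc (Suc (Suc n))) = trib (Suc (Suc n)) + trib (Suc n) + trib n"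

definition canonical_trib_expansion :: "(nat \<Rightarrow> nat) \<Rightarrow> nat \<Rightarrow> bool" where
  "canonical_trib_expansion x N \<longleftrightarrow>
     (\<forall>h. x h \<in> {0, 1}) \<and> finite {h. x h \<noteq> 0} \<and>
     (\<nexists>h. x h = 1 \<and> x (h + 1) = 1 \<and> x (h + 2) = 1) \<and>
     N = (\<Sum>h. x h * trib h)"

(* The argument x is meant to be the canonical expansion of N. *)
definition gamma3 :: "(nat \<Rightarrow> nat) \<Rightarrow> nat \<Rightarrow> real" where
  "gamma3 x N = 1 / real N *
     ((\<Sum>h. real (x h) * tribonacci_const ^ h) - 2 * (tribonacci_const\<^sup>2 - 1))"

(* Since trib starts 1, 2, 4, trib h is asymptotic to trib_C1 * tribonacci_const ^ (h + 3). *)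
definition trib_C1 :: real where
  "trib_C1 = 1 / (3 * tribonacci_const\<^sup>2 - 2 * tribonacci_const - 1)"

lemma tribonacci_const_root: "tribonacci_const ^ 3 - tribonacci_const ^ 2 - tribonacci_const - 1 = 0"
  and tribonacci_const_gt_1: "tribonacci_const > 1"
  and tribonacci_const_largest: "x ^ 3 - x ^ 2 - x - 1 = 0 \<Longrightarrow> x \<le> tribonacci_const"
proof -
  let ?R = "{x::real. x ^ 3 - x ^ 2 - x - 1 = 0}"
  have "?R = {x. poly [:-1, -1, -1, 1:] x = 0}"
    by (auto simp: power2_eq_square power3_eq_cube algebra_simps)
  then have fin: "finite ?R"
    using poly_roots_finite[of "[:-1, -1, -1, 1::real:]"] by simp
  have "\<exists>x::real. 1 \<le> x \<and> x \<le> 2 \<and> x ^ 3 - x ^ 2 - x - 1 = 0"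
    by (rule IVT') (auto intro!: continuous_intros)
  then obtain r :: real where r: "1 \<le> r" "r \<in> ?R" by auto
  then have "r \<noteq> 1" by auto
  with r have "1 < r" by simp
  moreover have "r \<le> tribonacci_const"
    unfolding tribonacci_const_def using fin r by (intro Max_ge)
  ultimately show "tribonacci_const > 1" by simp
  have "tribonacci_const \<in> ?R"
    unfolding tribonacci_const_def using fin r by (intro Max_in) auto
  then show "tribonacci_const ^ 3 - tribonacci_const ^ 2 - tribonacci_const - 1 = 0" by simp
  show "x \<le> tribonacci_const" if "x ^ 3 - x ^ 2 - x - 1 = 0"
    unfolding tribonacci_const_def using fin that by (intro Max_ge) auto
qed

lemma ex_strict_mono_listing:
  fixes S :: "real set"
  assumes inf: "infinite S" and fin: "\<And>M. finite {s \<in> S. s \<le> M}"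
  shows "\<exists>l::nat \<Rightarrow> real. strict_mono l \<and> range l = S"
proof -
  have least: "\<exists>y\<in>A. \<forall>s\<in>A. y \<le> s" if A: "A \<subseteq> S" "A \<noteq> {}" for A
  proof -
    obtain a where a: "a \<in> A" using A(2) by blast
    have f: "finite {s \<in> A. s \<le> a}"
      by (rule finite_subset[OF _ fin[of a]]) (use A in auto)
    have m: "Min {s \<in> A. s \<le> a} \<in> {s \<in> A. s \<le> a}"
      by (rule Min_in[OF f]) (use a in auto)
    have "Min {s \<in> A. s \<le> a} \<le> s" if "s \<in> A" for s
      using m f that by (cases "s \<le> a") auto
    with m show ?thesis by blast
  qed
  have "\<exists>y. y \<in> S \<and> x < y \<and> (\<forall>s\<in>S. x < s \<longrightarrow> y \<le> s)" for x
  proof -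
    have "{s \<in> S. x < s} \<noteq> {}"
    proof
      assume "{s \<in> S. x < s} = {}"
      then have "S = {s \<in> S. s \<le> x}" by force
      with inf fin[of x] show False by simp
    qed
    then show ?thesis using least[of "{s \<in> S. x < s}"] by auto
  qed
  then obtain nxt where nxt: "\<And>x. nxt x \<in> S" "\<And>x. x < nxt x"
    "\<And>x s. s \<in> S \<Longrightarrow> x < s \<Longrightarrow> nxt x \<le> s"
    by metis
  obtain m where m: "m \<in> S" "\<And>s. s \<in> S \<Longrightarrow> m \<le> s"
    using least[of S] inf by fastforce
  define l where "l = rec_nat m (\<lambda>_. nxt)"
  have l0: "l 0 = m" and lS: "\<And>n. l (Suc n) = nxt (l n)" by (simp_all add: l_def)
  have mono: "strict_mono l" by (simp add: strict_mono_Suc_iff lS nxt)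
  have sub: "l n \<in> S" for n by (cases n) (simp_all add: l0 lS m nxt)
  have "s \<in> range l" if s: "s \<in> S" for s
  proof (rule ccontr)
    assume ns: "s \<notin> range l"
    have "l n \<le> s" for n
    proof (induction n)
      case 0 then show ?case using m s by (simp add: l0)
    next
      case (Suc n)
      then have "l n < s" using ns by (metis order_le_less rangeI)
      then show ?case using nxt(3) s by (simp add: lS)
    qed
    then have "range l \<subseteq> {t \<in> S. t \<le> s}" using sub by auto
    then have "finite (range l)" using fin finite_subset by blast
    moreover have "inj l" using mono by (rule strict_mono_imp_inj_on)
    ultimately show False using finite_imageD by blast
  qed
  then show ?thesis using mono sub by blast
qed

lemma strict_mono_listing_le:
  fixes f g :: "nat \<Rightarrow> real"
  assumes f: "strict_mono f" and g: "strict_mono g" and sub: "range g \<subseteq> range f"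
  shows "f n \<le> g n"
proof -
  have "\<forall>k. \<exists>j. g k = f j" using sub by blast
  then obtain h where h: "\<And>k. g k = f (h k)" by metis
  have "strict_mono h"
    using g f by (simp add: strict_mono_def h) (metis strict_mono_less f h)
  then have "n \<le> h n" by (rule strict_mono_imp_increasing)
  then show ?thesis using f by (simp add: h strict_mono_less_eq)
qed

lemma pow_in_pow_spectrum: "q ^ n \<in> pow_spectrum q"
proof -
  have "(\<Sum>i\<le>n. (if i = n then 1 else 0) * q ^ i) = q ^ n"
    by (simp add: if_distrib[of "\<lambda>c. c * _"] cong: if_cong)
  then show ?thesis unfolding pow_spectrum_def
    by (intro CollectI exI[of _ n] exI[of _ "\<lambda>i. if i = n then 1 else 0"]) auto
qed

lemma finite_pow_spectrum_le:
  assumes "q > 1"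
  shows "finite {s \<in> pow_spectrum q. s \<le> M}"
proof -
  obtain m where m: "M < q ^ m" using real_arch_pow[OF assms] by blast
  have "{s \<in> pow_spectrum q. s \<le> M} \<subseteq> (\<lambda>A. \<Sum>i\<in>A. q ^ i) ` Pow {..m}"
  proof
    fix s assume "s \<in> {s \<in> pow_spectrum q. s \<le> M}"
    then obtain n and \<epsilon> :: "nat \<Rightarrow> real" where s: "s = (\<Sum>i\<le>n. \<epsilon> i * q ^ i)" "s \<le> M" and e: "\<forall>i\<le>n. \<epsilon> i \<in> {0, 1}"
      unfolding pow_spectrum_def by auto
    define A where "A = {i \<in> {..n}. \<epsilon> i = 1}"
    have "s = (\<Sum>i\<in>A. \<epsilon> i * q ^ i)"
      unfolding s A_def by (rule sum.mono_neutral_right) (use e in auto)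
    also have "\<dots> = (\<Sum>i\<in>A. q ^ i)"
      by (rule sum.cong) (auto simp: A_def)
    finally have sA: "s = (\<Sum>i\<in>A. q ^ i)" .
    have "i \<le> m" if "i \<in> A" for i
    proof (rule ccontr)
      assume "\<not> i \<le> m"
      then have "q ^ m \<le> q ^ i" using assms by (intro power_increasing) auto
      also have "q ^ i \<le> (\<Sum>i\<in>A. q ^ i)"
        by (rule member_le_sum) (use that assms in \<open>auto simp: A_def\<close>)
      finally show False using m s(2) sA by simp
    qed
    then show "s \<in> (\<lambda>A. \<Sum>i\<in>A. q ^ i) ` Pow {..m}" using sA by auto
  qed
  then show ?thesis by (rule finite_subset) auto
qed

lemma ex1_spectrum_listing:
  assumes "q > 1"
  shows "\<exists>!l::nat \<Rightarrow> real. strict_mono l \<and> range l = pow_spectrum q"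
proof -
  have "inj (\<lambda>n. q ^ n)" using assms by (auto simp: inj_on_def)
  then have "infinite (range (\<lambda>n. q ^ n))" by (rule range_inj_infinite)
  moreover have "range (\<lambda>n. q ^ n) \<subseteq> pow_spectrum q" using pow_in_pow_spectrum by auto
  ultimately have "infinite (pow_spectrum q)" using finite_subset by blast
  then have "\<exists>l::nat \<Rightarrow> real. strict_mono l \<and> range l = pow_spectrum q"
    using finite_pow_spectrum_le[OF assms] by (rule ex_strict_mono_listing)
  moreover have "f = g" if "strict_mono f \<and> range f = pow_spectrum q"
    "strict_mono g \<and> range g = pow_spectrum q" for f g :: "nat \<Rightarrow> real"
    using strict_mono_listing_le[of f g] strict_mono_listing_le[of g f] that
    by (intro ext antisym) auto
  ultimately show ?thesis by (intro ex_ex1I) auto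
qed

lemma spectrum_listing:
  assumes "q > 1"
  shows "strict_mono (spectrum_listing q)" "range (spectrum_listing q) = pow_spectrum q"
  using theI'[OF ex1_spectrum_listing[OF assms]] by (simp_all add: spectrum_listing_def)

lemma ex_canonical_trib_expansion: "\<exists>x. canonical_trib_expansion x N"
proof -
  define P where "P x N m \<longleftrightarrow> (\<forall>h. x h \<in> {0, 1::nat}) \<and> (\<forall>h\<ge>m. x h = 0) \<and>
     (\<nexists>h. x h = 1 \<and> x (h + 1) = 1 \<and> x (h + 2) = 1) \<and> N = (\<Sum>h<m. x h * trib h)"
    for x :: "nat \<Rightarrow> nat" and N m
  have up: "P x N (Suc m)" if "P x N m" for x N m
    using that unfolding P_def by auto
  have add: "P (x(Suc m := 1)) (N + trib (Suc m)) (Suc (Suc m))" if "P x N m" for x N m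
  proof -
    have "\<not> ((x(Suc m := 1)) h = 1 \<and> (x(Suc m := 1)) (h + 1) = 1 \<and> (x(Suc m := 1)) (h + 2) = 1)" for h
      using that unfolding P_def by (cases "h = Suc m"; cases "h = m"; cases "Suc h = m") auto
    then show ?thesis using that unfolding P_def by auto
  qed
  have add2: "P (x(Suc m := 1, Suc (Suc m) := 1)) (N + trib (Suc m) + trib (Suc (Suc m))) (Suc (Suc (Suc m)))"
    if "P x N m" for x N m
  proof -
    let ?y = "x(Suc m := 1, Suc (Suc m) := 1)"
    have "\<not> (?y h = 1 \<and> ?y (h + 1) = 1 \<and> ?y (h + 2) = 1)" for h
      using that unfolding P_def by (cases "h = Suc m"; cases "h = m"; cases "Suc h = m") auto
    then show ?thesis using that unfolding P_def by auto
  qed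
  have P0: "P (\<lambda>_. 0) 0 0" unfolding P_def by simp
  have P01: "P (\<lambda>_. 0) 0 (Suc 0)" using P0 by (rule up)
  have P1: "P ((\<lambda>_. 0)(0 := 1)) 1 1" unfolding P_def by auto
  have "\<forall>N<trib m. \<exists>x. P x N m" for m
  proof (induction m rule: less_induct)
    case (less m)
    consider "m = 0" | "m = 1" | "m = 2" | k where "m = Suc (Suc (Suc k))"
      by (metis One_nat_def numeral_2_eq_2 not0_implies_Suc)
    then show ?case
    proof cases
      case 1 then show ?thesis using P0 by auto
    next
      case 2
      have "\<exists>x. P x N 1" if "N < 2" for N
      proof (cases "N = 0")
        case True then show ?thesis using P01 by auto
      next
        case False
        then have "N = 1" using that by simp
        then show ?thesis using P1 by auto
      qed
      then show ?thesis using 2 by simp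
    next
      case 3
      have "\<exists>x. P x N 2" if N: "N < 4" for N
      proof -
        consider "N = 0" | "N = 1" | "N = 2" | "N = 3" using N by linarith
        then show ?thesis
        proof cases
          case 1 then show ?thesis using up[OF P01] by (auto simp: numeral_2_eq_2)
        next
          case 2 then show ?thesis using up[OF P1] by (auto simp: numeral_2_eq_2)
        next
          case 3 then show ?thesis using add[OF P0] by (auto simp: numeral_2_eq_2)
        next
          case 4
          have "P (\<lambda>h. if h < 2 then 1 else 0) 3 2" unfolding P_def
            by (auto simp: numeral_2_eq_2)
          then show ?thesis using 4 by auto
        qed
      qed
      then show ?thesis using 3 by (simp add: numeral_2_eq_2)
    next
      case (4 k)
      show ?thesis
      proof (intro allI impI)
        fix N assume N: "N < trib m"
        consider "N < trib (Suc (Suc k))"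
          | "trib (Suc (Suc k)) \<le> N" "N - trib (Suc (Suc k)) < trib (Suc k)"
          | "trib (Suc (Suc k)) + trib (Suc k) \<le> N" "N - trib (Suc k) - trib (Suc (Suc k)) < trib k"
          using N 4 by simp linarith
        then show "\<exists>x. P x N m"
        proof cases
          case 1
          then show ?thesis using less.IH[of "Suc (Suc k)"] up 4 by blast
        next
          case 2
          then obtain x where "P x (N - trib (Suc (Suc k))) (Suc k)"
            using less.IH[of "Suc k"] 4 by auto
          from add[OF this] show ?thesis using 2 4 by auto
        next
          case 3
          then obtain x where "P x (N - trib (Suc k) - trib (Suc (Suc k))) k"
            using less.IH[of k] 4 by auto
          moreover have "N - trib (Suc k) - trib (Suc (Suc k)) + trib (Suc k) + trib (Suc (Suc k)) = N"
            using 3 by linarith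
          ultimately show ?thesis using add2 4 by metis
        qed
      qed
    qed
  qed
  moreover have "n < trib n" for n by (induction n rule: trib.induct) auto
  ultimately obtain x where x: "P x N N" by blast
  have "finite {h. x h \<noteq> 0}"
    by (rule finite_subset[of _ "{..<N}"]) (use x in \<open>auto simp: P_def not_less[symmetric]\<close>)
  moreover have "(\<Sum>h. x h * trib h) = (\<Sum>h<N. x h * trib h)"
    by (rule suminf_finite) (use x in \<open>auto simp: P_def\<close>)
  ultimately show ?thesis using x unfolding P_def canonical_trib_expansion_def by auto
qed

end

theory Submission
  imports Defs
begin

text \<open>
  Write \<open>\<tau>\<close> for the Tribonacci constant, \<open>T\<close> for the Tribonacci sequence and
  \<open>v(A) = \<Sum>i\<in>A. \<tau> ^ i\<close>. Because \<open>\<tau> ^ 3 = \<tau>\<^sup>2 + \<tau> + 1\<close>, every finite set of exponents can be carried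
  into one without three consecutive members, so the spectrum is the set of the \<open>v(A)\<close> with \<open>A\<close> free
  of such triples. Two triple-free sets are compared by the largest exponent at which they differ,
  and this comparison decides both the order of the values \<open>v(A)\<close> and that of the integers
  \<open>\<Sum>i\<in>A. T i\<close>: a triple-free set below \<open>m\<close> always weighs less than the single exponent \<open>m\<close>. Hence
  the \<open>N\<close>-th spectrum element is obtained from the canonical expansion of \<open>N\<close> by replacing \<open>T i\<close>
  with \<open>\<tau> ^ i\<close> (\<open>spectrum_listing_tribonacci\<close>).

  With \<open>c = C\<^sub>1 \<tau> ^ 3\<close>, the difference \<open>T h - c \<tau> ^ h\<close> contains only the two conjugates of \<open>\<tau>\<close>, which lie
  inside the unit disc; its sum over any finite set of exponents lies between \<open>-1\<close> and \<open>1/2\<close>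
  (\<open>sum_trib_err_le\<close>, \<open>sum_trib_err_ge\<close>). So \<open>c \<lambda>\<^sub>N\<close> differs from \<open>N\<close> by a quantity in this interval.
  Then \<open>c (\<lambda>\<^bsub>N+k\<^esub> - \<lambda>\<^sub>k - \<lambda>\<^sub>N)\<close> is at least \<open>-5/2\<close>, which is well above \<open>-2c(\<tau>\<^sup>2 - 1)\<close> and yields the first
  estimate, and \<open>c \<lambda>\<^sub>N \<ge> N - 1/2\<close> yields the second, because the logarithm occurring there is at
  least \<open>3\<close>.

  For \<open>N = 2\<close> the comparison of triple-free sets is made quantitative: spectrum elements differ by at
  least \<open>1/\<tau>\<close>, and by at least \<open>1\<close> when the exponent \<open>0\<close> is missing from the smaller one or present
  in both. Of two successive gaps at least one is of the second kind, and
  \<open>1 + 1/\<tau> = \<tau>\<^sup>2 - \<tau>\<close>.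
\<close>

section \<open>Sets without three consecutive members\<close>

definition triple_free :: "nat set \<Rightarrow> bool" where
  "triple_free A \<longleftrightarrow> finite A \<and> (\<forall>h. \<not> (h \<in> A \<and> h + 1 \<in> A \<and> h + 2 \<in> A))"

lemma triple_free_finite: "triple_free A \<Longrightarrow> finite A"
  by (simp add: triple_free_def)

lemma triple_free_subset: "triple_free A \<Longrightarrow> B \<subseteq> A \<Longrightarrow> triple_free B"
  unfolding triple_free_def by (meson finite_subset subsetD)

text \<open>Comparison of binary expansions at their most significant differing digit. The position of that
  digit is kept because the estimate for the difference of the values depends on it.\<close>
definition leads_at :: "nat set \<Rightarrow> nat set \<Rightarrow> nat \<Rightarrow> bool" where
  "leads_at A B m \<longleftrightarrow> m \<in> A \<and> m \<notin> B \<and> A \<inter> {m<..} = B \<inter> {m<..}"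

lemma leads_at_cases:
  assumes "finite A" "finite B" "A \<noteq> B"
  obtains m where "leads_at A B m" | m where "leads_at B A m"
proof -
  let ?D = "(A - B) \<union> (B - A)"
  have D: "finite ?D" "?D \<noteq> {}" using assms by auto
  let ?m = "Max ?D"
  have m: "?m \<in> ?D" using D by (rule Max_in)
  have "h \<notin> ?D" if "h > ?m" for h
    using Max_ge[OF D(1), of h] that by linarith
  then have "A \<inter> {?m<..} = B \<inter> {?m<..}" by blast
  with m that show thesis unfolding leads_at_def by blast
qed

lemma nat_cases3:
  obtains "n = 0" | "n = 1" | "n = (2::nat)" | k where "n = k + 3"
proof -
  have "n = 0 \<or> n = 1 \<or> n = 2 \<or> (\<exists>k. n = k + 3)" by presburger
  then show thesis using that by blast
qed

text \<open>
  Both sequences to which this locale is applied, \<open>T\<close> and the powers of \<open>\<tau>\<close>, satisfy the Tribonacci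
  recurrence. The constant \<open>\<delta>\<close> is a lower bound for the gaps between values of triple-free sets; the
  three initial conditions say that it is one for sets of exponents below \<open>3\<close>.
\<close>
locale trib_weight =
  fixes w :: "nat \<Rightarrow> real" and \<delta> :: real
  assumes rec: "w (n + 3) = w (n + 2) + w (n + 1) + w n"
    and pos: "\<delta> > 0"
    and init: "\<delta> \<le> w 0" "w 0 + \<delta> \<le> w 1" "w 0 + w 1 + \<delta> \<le> w 2"
begin

lemma weight_pos: "w n > 0"
proof (induction n rule: less_induct)
  case (less n)
  show ?case
  proof (cases n rule: nat_cases3)
    case (4 k)
    then show ?thesis using less[of k] less[of "k + 1"] less[of "k + 2"] rec[of k] by simp
  qed (use pos init in auto)
qed

lemma weight_mono_Suc: "w (n + 2) \<le> w (n + 3)"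
  using rec[of n] weight_pos[of n] weight_pos[of "n + 1"] by simp

text \<open>
  The heaviest triple-free set below \<open>m + 3\<close> has the digit pattern \<open>110\<close> on top, and the pattern
  \<open>110\<close> falls short of the exponent \<open>m + 3\<close> by exactly \<open>w m\<close>; the shortfall is therefore passed on
  unchanged from \<open>m\<close> to \<open>m + 3\<close>.
\<close>
lemma sum_below:
  assumes "triple_free B" "B \<subseteq> {..<m}"
  shows "sum w B + \<delta> \<le> w m"
  using assms
proof (induction m arbitrary: B rule: less_induct)
  case (less m)
  have fin: "finite B" using less.prems triple_free_finite by blast
  show ?case
  proof (cases m rule: nat_cases3)
    case 1
    then show ?thesis using less.prems init by simp
  next
    case 2
    have "sum w B \<le> sum w {..<1}"
      by (rule sum_mono2) (use less.prems 2 weight_pos in \<open>auto intro: less_imp_le\<close>)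
    then show ?thesis using 2 init by simp
  next
    case 3
    have "sum w B \<le> sum w {..<2}"
      by (rule sum_mono2) (use less.prems 3 weight_pos in \<open>auto intro: less_imp_le\<close>)
    then show ?thesis using 3 init by (simp add: numeral_2_eq_2)
  next
    case (4 k)
    show ?thesis
    proof (cases "k + 2 \<in> B")
      case False
      have "B \<subseteq> {..<k + 2}"
      proof
        fix i assume "i \<in> B"
        then have "i < k + 3" "i \<noteq> k + 2" using less.prems 4 False by auto
        then show "i \<in> {..<k + 2}" by simp
      qed
      then have "sum w B + \<delta> \<le> w (k + 2)" using less.IH[of "k + 2"] less.prems 4 by simp
      then show ?thesis using weight_mono_Suc[of k] 4 by simp
    next
      case top: True
      have s2: "sum w B = w (k + 2) + sum w (B - {k + 2})"
        using fin top by (rule sum.remove)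
      show ?thesis
      proof (cases "k + 1 \<in> B")
        case False
        have "B - {k + 2} \<subseteq> {..<k + 1}"
        proof
          fix i assume "i \<in> B - {k + 2}"
          then have "i < k + 3" "i \<noteq> k + 2" "i \<noteq> k + 1" using less.prems 4 False by auto
          then show "i \<in> {..<k + 1}" by simp
        qed
        then have "sum w (B - {k + 2}) + \<delta> \<le> w (k + 1)"
          using less.IH[of "k + 1" "B - {k + 2}"] less.prems 4 triple_free_subset by simp
        then show ?thesis using s2 4 rec[of k] weight_pos[of k] by simp
      next
        case next_top: True
        let ?B = "B - {k + 2} - {k + 1}"
        have s1: "sum w (B - {k + 2}) = w (k + 1) + sum w ?B"
          using fin next_top by (intro sum.remove) auto
        have "k \<notin> B" using less.prems(1) top next_top unfolding triple_free_def by blast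
        have "?B \<subseteq> {..<k}"
        proof
          fix i assume "i \<in> ?B"
          then have "i < k + 3" "i \<noteq> k + 2" "i \<noteq> k + 1" "i \<noteq> k"
            using less.prems 4 \<open>k \<notin> B\<close> by auto
          then show "i \<in> {..<k}" by simp
        qed
        moreover have "triple_free ?B" using less.prems(1) by (rule triple_free_subset) auto
        ultimately have "sum w ?B + \<delta> \<le> w k" using less.IH[of k ?B] 4 by simp
        then show ?thesis using s1 s2 4 rec[of k] by simp
      qed
    qed
  qed
qed

lemma sum_diff_ge_leading:
  assumes "finite A" "finite B" "leads_at A B m"
  shows "sum w A - sum w B \<ge> w m - sum w (B \<inter> {..<m})"
proof -
  have A: "A = (A \<inter> {m<..}) \<union> insert m (A \<inter> {..<m})"
    and B: "B = (B \<inter> {m<..}) \<union> (B \<inter> {..<m})"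
    using assms(3) unfolding leads_at_def by (auto intro: linorder_neqE_nat)
  have "sum w A = sum w (A \<inter> {m<..}) + sum w (insert m (A \<inter> {..<m}))"
    by (subst A, rule sum.union_disjoint) (use assms in auto)
  moreover have "sum w (insert m (A \<inter> {..<m})) = w m + sum w (A \<inter> {..<m})"
    using assms by (intro sum.insert) auto
  moreover have "sum w B = sum w (B \<inter> {m<..}) + sum w (B \<inter> {..<m})"
    by (subst B, rule sum.union_disjoint) (use assms in auto)
  moreover have "sum w (A \<inter> {..<m}) \<ge> 0"
    using weight_pos by (intro sum_nonneg) (auto intro: less_imp_le)
  ultimately show ?thesis using assms(3) unfolding leads_at_def by simp
qed

lemma leads_at_sum_gap:
  assumes "finite A" "triple_free B" "leads_at A B m"
  shows "sum w A \<ge> sum w B + \<delta>"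
proof -
  have "triple_free (B \<inter> {..<m})" using assms(2) by (rule triple_free_subset) auto
  from sum_below[OF this, of m] show ?thesis
    using sum_diff_ge_leading[OF assms(1) triple_free_finite[OF assms(2)] assms(3)] by simp
qed

lemma sum_less_imp_leads_at:
  assumes "triple_free A" "triple_free B" "sum w A < sum w B"
  obtains m where "leads_at B A m"
proof -
  have "finite A" "finite B" "A \<noteq> B" using assms triple_free_finite by auto
  then show thesis
    by (rule leads_at_cases)
       (use assms that leads_at_sum_gap[of A B] pos triple_free_finite in fastforce)+
qed

text \<open>Replacing the topmost block of three consecutive exponents by the exponent above it shortens
  the set and keeps its weight.\<close>
lemma ex_triple_free_same_sum:
  assumes "finite A"
  shows "\<exists>B. triple_free B \<and> sum w B = sum w A"
  using assms
proof (induction "card A" arbitrary: A rule: less_induct)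
  case less
  let ?H = "{h. h \<in> A \<and> h + 1 \<in> A \<and> h + 2 \<in> A}"
  show ?case
  proof (cases "?H = {}")
    case True
    then have "triple_free A" using less.prems unfolding triple_free_def by blast
    then show ?thesis by blast
  next
    case False
    have finH: "finite ?H" using less.prems by (rule rev_finite_subset) auto
    define h where "h = Max ?H"
    have h: "h \<in> ?H" unfolding h_def using finH False by (rule Max_in)
    \<comment> \<open>The carry lands on a free place because \<open>h\<close> was chosen maximal.\<close>
    have new: "h + 3 \<notin> A"
    proof
      assume "h + 3 \<in> A"
      then have "h + 1 \<in> ?H" using h by (simp add: numeral_eq_Suc)
      then have "h + 1 \<le> h" unfolding h_def using finH by (intro Max_ge)
      then show False by simp
    qed
    let ?C = "A - {h, h + 1, h + 2}"
    have sub: "{h, h + 1, h + 2} \<subseteq> A" using h by auto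
    have "card ?C = card A - 3" "card A \<ge> 3"
      using card_Diff_subset[OF _ sub] card_mono[OF less.prems sub] by simp_all
    then have "card (insert (h + 3) ?C) < card A" using less.prems new by simp
    moreover have "sum w A = sum w ?C + sum w {h, h + 1, h + 2}"
      using sum.subset_diff[OF sub less.prems] .
    then have "sum w (insert (h + 3) ?C) = sum w A"
      using less.prems new rec[of h] by simp
    ultimately show ?thesis using less.hyps[of "insert (h + 3) ?C"] less.prems by auto
  qed
qed

end

section \<open>Tribonacci numbers and powers of the Tribonacci constant\<close>

abbreviation \<tau> :: real where "\<tau> \<equiv> tribonacci_const"

lemma tribonacci_const_cube: "\<tau> ^ 3 = \<tau>\<^sup>2 + \<tau> + 1"
  using tribonacci_const_root by simp

lemma tribonacci_const_bounds: "1839 / 1000 \<le> \<tau>" "\<tau> \<le> 184 / 100"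
proof -
  have fac: "\<tau> ^ 3 - \<tau> ^ 2 - \<tau> - 1 - (a ^ 3 - a ^ 2 - a - 1)
      = (\<tau> - a) * (\<tau> * (\<tau> - 1) + a * (a - 1) + (\<tau> * a - 1))" for a :: real
    by (simp add: power2_eq_square power3_eq_cube algebra_simps)
  have pos: "\<tau> * (\<tau> - 1) + a * (a - 1) + (\<tau> * a - 1) > 0" if "a > 1" for a :: real
    using tribonacci_const_gt_1 that less_1_mult[of \<tau> a]
    by (intro add_pos_pos) simp_all
  have "0 < (\<tau> - 1839 / 1000) * (\<tau> * (\<tau> - 1) + 1839 / 1000 * (1839 / 1000 - 1) + (\<tau> * (1839 / 1000) - 1))"
    unfolding fac[symmetric] tribonacci_const_root by (simp add: power2_eq_square power3_eq_cube)
  with pos[of "1839 / 1000"] show "1839 / 1000 \<le> \<tau>"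
    by (simp add: zero_less_mult_iff)
  have "(\<tau> - 184 / 100) * (\<tau> * (\<tau> - 1) + 184 / 100 * (184 / 100 - 1) + (\<tau> * (184 / 100) - 1)) < 0"
    unfolding fac[symmetric] tribonacci_const_root by (simp add: power2_eq_square power3_eq_cube)
  with pos[of "184 / 100"] show "\<tau> \<le> 184 / 100"
    by (simp add: mult_less_0_iff)
qed

lemma tribonacci_const_square_bounds: "3381 / 1000 \<le> \<tau>\<^sup>2" "\<tau>\<^sup>2 \<le> 3386 / 1000"
proof -
  have "(1839 / 1000)\<^sup>2 \<le> \<tau>\<^sup>2" using tribonacci_const_bounds by (intro power_mono) auto
  then show "3381 / 1000 \<le> \<tau>\<^sup>2" by (simp add: power2_eq_square)
  have "\<tau>\<^sup>2 \<le> (184 / 100)\<^sup>2" using tribonacci_const_bounds by (intro power_mono) auto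
  then show "\<tau>\<^sup>2 \<le> 3386 / 1000" by (simp add: power2_eq_square)
qed

text \<open>The smallest gap of the spectrum, \<open>\<tau>\<^sup>2 - \<tau> - 1\<close>, is therefore \<open>1/\<tau>\<close>.\<close>
lemma tribonacci_const_inverse: "\<tau> * (\<tau>\<^sup>2 - \<tau> - 1) = 1"
  using tribonacci_const_cube by (simp add: algebra_simps power2_eq_square power3_eq_cube)

interpretation trib_nat: trib_weight "\<lambda>n. real (trib n)" 1
  by unfold_locales (simp_all add: numeral_eq_Suc)

interpretation trib_pow: trib_weight "\<lambda>n. \<tau> ^ n" "\<tau>\<^sup>2 - \<tau> - 1"
proof
  fix n
  have "\<tau> ^ (n + 3) = \<tau> ^ n * (\<tau>\<^sup>2 + \<tau> + 1)"
    unfolding tribonacci_const_cube[symmetric] by (rule power_add)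
  then show "\<tau> ^ (n + 3) = \<tau> ^ (n + 2) + \<tau> ^ (n + 1) + \<tau> ^ n"
    by (simp add: power_add power2_eq_square algebra_simps)
qed (use tribonacci_const_bounds tribonacci_const_square_bounds in simp_all)

section \<open>The spectrum listed by canonical expansions\<close>

definition spectrum_val :: "nat set \<Rightarrow> real" where
  "spectrum_val A = (\<Sum>i\<in>A. \<tau> ^ i)"

lemma pow_spectrum_eq_triple_free: "pow_spectrum \<tau> = spectrum_val ` {A. triple_free A}"
proof (intro set_eqI iffI)
  fix s assume "s \<in> pow_spectrum \<tau>"
  then obtain n and \<epsilon> :: "nat \<Rightarrow> real"
    where s: "s = (\<Sum>i\<le>n. \<epsilon> i * \<tau> ^ i)" and e: "\<forall>i\<le>n. \<epsilon> i \<in> {0, 1}"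
    unfolding pow_spectrum_def by auto
  define A where "A = {i \<in> {..n}. \<epsilon> i = 1}"
  have "s = (\<Sum>i\<in>A. \<epsilon> i * \<tau> ^ i)"
    unfolding s A_def by (rule sum.mono_neutral_right) (use e in auto)
  also have "\<dots> = (\<Sum>i\<in>A. \<tau> ^ i)"
    by (rule sum.cong) (auto simp: A_def)
  finally have "s = (\<Sum>i\<in>A. \<tau> ^ i)" .
  moreover have "finite A" unfolding A_def by simp
  ultimately obtain B where "triple_free B" "s = (\<Sum>i\<in>B. \<tau> ^ i)"
    using trib_pow.ex_triple_free_same_sum[of A] by auto
  then show "s \<in> spectrum_val ` {A. triple_free A}" by (auto simp: spectrum_val_def)
next
  fix s assume "s \<in> spectrum_val ` {A. triple_free A}"
  then obtain A where A: "triple_free A" and s: "s = (\<Sum>i\<in>A. \<tau> ^ i)" by (auto simp: spectrum_val_def)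
  define n where "n = Max (insert 0 A)"
  have sub: "A \<subseteq> {..n}" unfolding n_def using triple_free_finite[OF A] by auto
  define \<epsilon> :: "nat \<Rightarrow> real" where "\<epsilon> i = (if i \<in> A then 1 else 0)" for i
  have "(\<Sum>i\<le>n. \<epsilon> i * \<tau> ^ i) = (\<Sum>i\<in>A. \<epsilon> i * \<tau> ^ i)"
    by (rule sum.mono_neutral_right) (use sub in \<open>auto simp: \<epsilon>_def\<close>)
  also have "\<dots> = s" unfolding s by (rule sum.cong) (auto simp: \<epsilon>_def)
  finally have "s = (\<Sum>i\<le>n. \<epsilon> i * \<tau> ^ i)" ..
  moreover have "\<forall>i\<le>n. \<epsilon> i \<in> {0, 1}" by (simp add: \<epsilon>_def)
  ultimately show "s \<in> pow_spectrum \<tau>" unfolding pow_spectrum_def by blast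
qed

lemma canonical_trib_expansionD:
  assumes "canonical_trib_expansion x N"
  shows "triple_free {h. x h \<noteq> 0}" "N = sum trib {h. x h \<noteq> 0}"
    "(\<Sum>h. real (x h) * \<tau> ^ h) = spectrum_val {h. x h \<noteq> 0}"
proof -
  let ?A = "{h. x h \<noteq> 0}"
  have fin: "finite ?A"
    and free: "\<And>h. \<not> (x h = 1 \<and> x (h + 1) = 1 \<and> x (h + 2) = 1)"
    and N: "N = (\<Sum>h. x h * trib h)"
    using assms unfolding canonical_trib_expansion_def by blast+
  have bin: "x h = 1" if "x h \<noteq> 0" for h
    using assms that unfolding canonical_trib_expansion_def by (metis insertE singletonD)
  show "triple_free ?A" using fin free bin unfolding triple_free_def by blast
  have "N = (\<Sum>h\<in>?A. x h * trib h)" unfolding N by (rule suminf_finite[OF fin]) simp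
  also have "\<dots> = sum trib ?A" by (rule sum.cong) (use bin in auto)
  finally show "N = sum trib ?A" .
  have "(\<Sum>h. real (x h) * \<tau> ^ h) = (\<Sum>h\<in>?A. real (x h) * \<tau> ^ h)"
    by (rule suminf_finite[OF fin]) simp
  also have "\<dots> = spectrum_val ?A"
    unfolding spectrum_val_def by (rule sum.cong) (use bin in auto)
  finally show "(\<Sum>h. real (x h) * \<tau> ^ h) = spectrum_val ?A" .
qed

lemma ex_triple_free_sum_trib: "\<exists>A. triple_free A \<and> sum trib A = N"
  using ex_canonical_trib_expansion[of N] canonical_trib_expansionD by metis

text \<open>Both orders are decided by the largest exponent at which the sets differ.\<close>
lemma spectrum_val_less_iff:
  assumes "triple_free A" "triple_free B"
  shows "spectrum_val A < spectrum_val B \<longleftrightarrow> sum trib A < sum trib B"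
proof
  assume "spectrum_val A < spectrum_val B"
  then obtain m where "leads_at B A m"
    unfolding spectrum_val_def using assms trib_pow.sum_less_imp_leads_at by blast
  from trib_nat.leads_at_sum_gap[OF triple_free_finite[OF assms(2)] assms(1) this]
  have "real (sum trib A) < real (sum trib B)" by simp
  then show "sum trib A < sum trib B" by (simp only: of_nat_less_iff)
next
  assume "sum trib A < sum trib B"
  then have "(\<Sum>i\<in>A. real (trib i)) < (\<Sum>i\<in>B. real (trib i))"
    by (metis of_nat_less_iff of_nat_sum)
  then obtain m where "leads_at B A m"
    using assms trib_nat.sum_less_imp_leads_at by blast
  from trib_pow.leads_at_sum_gap[OF triple_free_finite[OF assms(2)] assms(1) this]
  show "spectrum_val A < spectrum_val B"
    using trib_pow.pos by (simp add: spectrum_val_def)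
qed

lemma spectrum_listing_tribonacci:
  assumes "triple_free A"
  shows "spectrum_listing \<tau> (sum trib A) = spectrum_val A"
proof -
  obtain R where R: "\<And>N. triple_free (R N)" "\<And>N. sum trib (R N) = N"
    using ex_triple_free_sum_trib by metis
  define f where "f N = spectrum_val (R N)" for N
  have mono: "strict_mono f"
    by (rule strict_monoI) (simp add: f_def spectrum_val_less_iff R)
  have f: "f (sum trib B) = spectrum_val B" if "triple_free B" for B
    using spectrum_val_less_iff[OF R(1) that, of "sum trib B"]
      spectrum_val_less_iff[OF that R(1), of "sum trib B"] R(2)[of "sum trib B"]
    by (simp add: f_def)
  have "range f = pow_spectrum \<tau>"
    unfolding pow_spectrum_eq_triple_free
  proof (intro equalityI subsetI)
    show "s \<in> spectrum_val ` {A. triple_free A}" if "s \<in> range f" for s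
      using that R(1) by (auto simp: f_def)
    show "s \<in> range f" if "s \<in> spectrum_val ` {A. triple_free A}" for s
      using that f by (metis (mono_tags, lifting) imageE mem_Collect_eq rangeI)
  qed
  then have "spectrum_listing \<tau> = f"
    using ex1_spectrum_listing[OF tribonacci_const_gt_1] spectrum_listing[OF tribonacci_const_gt_1] mono
    by blast
  then show ?thesis using f[OF assms] by simp
qed

section \<open>The distance from a Tribonacci number to its dominant term\<close>

definition trib_err :: "nat \<Rightarrow> real" where
  "trib_err n = real (trib n) - trib_C1 * \<tau> ^ 3 * \<tau> ^ n"

lemma trib_C1_denominator_pos: "3 * \<tau>\<^sup>2 - 2 * \<tau> - 1 > 0"
  using tribonacci_const_bounds tribonacci_const_square_bounds by simp

lemma trib_C1_cube_bounds: "113 / 100 \<le> trib_C1 * \<tau> ^ 3" "trib_C1 * \<tau> ^ 3 \<le> 115 / 100"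
  unfolding trib_C1_def tribonacci_const_cube
  using trib_C1_denominator_pos tribonacci_const_bounds tribonacci_const_square_bounds
  by (simp_all add: divide_simps)

text \<open>The polynomial \<open>x\<^sup>2 + (\<tau> - 1)x + (\<tau>\<^sup>2 - \<tau> - 1)\<close> is the cofactor of \<open>x - \<tau>\<close> in \<open>x ^ 3 - x\<^sup>2 - x - 1\<close>. The
  value of \<open>C\<^sub>1\<close> is exactly the one for which the component along \<open>\<tau> ^ n\<close> cancels.\<close>
lemma trib_err_rec2: "trib_err (n + 2) + (\<tau> - 1) * trib_err (n + 1) + (\<tau>\<^sup>2 - \<tau> - 1) * trib_err n = 0"
proof (induction n)
  case 0
  have "trib_C1 * \<tau> ^ 3 * (3 * \<tau>\<^sup>2 - 2 * \<tau> - 1) = \<tau> ^ 3"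
    using trib_C1_denominator_pos unfolding trib_C1_def by simp
  then show ?case
    unfolding trib_err_def
    by (simp add: numeral_2_eq_2[symmetric] algebra_simps power2_eq_square power3_eq_cube)
      (use tribonacci_const_cube in \<open>simp add: numeral_2_eq_2 algebra_simps power2_eq_square power3_eq_cube\<close>)
next
  case (Suc n)
  have rec: "trib_err (n + 3) = trib_err (n + 2) + trib_err (n + 1) + trib_err n"
    using trib_nat.rec[of n] trib_pow.rec[of n] unfolding trib_err_def
    by (simp only: algebra_simps)
  have "trib_err (Suc n + 2) + (\<tau> - 1) * trib_err (Suc n + 1) + (\<tau>\<^sup>2 - \<tau> - 1) * trib_err (Suc n)
      = \<tau> * (trib_err (n + 2) + (\<tau> - 1) * trib_err (n + 1)) + trib_err n"
    using rec by (simp add: numeral_eq_Suc algebra_simps power2_eq_square)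
  also have "\<dots> = \<tau> * (trib_err (n + 2) + (\<tau> - 1) * trib_err (n + 1) + (\<tau>\<^sup>2 - \<tau> - 1) * trib_err n)"
    unfolding distrib_left mult.assoc[symmetric] tribonacci_const_inverse by simp
  finally show ?case using Suc by simp
qed

text \<open>The argument of the complex conjugate \<open>\<sigma>\<close> of \<open>\<tau>\<close> is about a third of a full turn, so \<open>\<sigma> ^ 3\<close>
  is a combination of \<open>\<sigma>\<close> and \<open>1\<close> with small nonnegative coefficients. Their sum \<open>4 - \<tau>\<^sup>2\<close> is less than
  \<open>5/8\<close>, which makes the errors summable by an elementary contraction.\<close>
lemma trib_err_rec3: "trib_err (n + 3) = (2 - \<tau>) * trib_err (n + 1) + (2 + \<tau> - \<tau>\<^sup>2) * trib_err n"
proof -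
  have rec: "trib_err (n + 3) = trib_err (n + 2) + trib_err (n + 1) + trib_err n"
    using trib_nat.rec[of n] trib_pow.rec[of n] unfolding trib_err_def
    by (simp only: algebra_simps)
  show ?thesis unfolding rec using trib_err_rec2[of n] by (simp add: algebra_simps)
qed

text \<open>The positive parts satisfy the recurrence as an inequality. Their partial sums \<open>P\<close> then satisfy
  \<open>P \<le> S + (5/8) P\<close> with \<open>S\<close> the sum of the first three positive parts, whence the factor \<open>8/3\<close>.\<close>
lemma contracting_sum_le:
  fixes e :: "nat \<Rightarrow> real"
  assumes rec: "\<And>n. e (n + 3) = a * e (n + 1) + b * e n"
    and a: "a \<ge> 0" and b: "b \<ge> 0" and ab: "a + b \<le> 5 / 8" and fin: "finite A"
  shows "sum e A \<le> 8 / 3 * (max 0 (e 0) + max 0 (e 1) + max 0 (e 2))"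
proof -
  define p where "p n = max 0 (e n)" for n
  define P where "P n = (\<Sum>h<n. p h)" for n
  have p0: "p n \<ge> 0" and ep: "e n \<le> p n" for n by (simp_all add: p_def)
  have step: "p (n + 3) \<le> a * p (n + 1) + b * p n" for n
  proof -
    have "e (n + 3) \<le> a * p (n + 1) + b * p n"
      unfolding rec using a b ep by (intro add_mono mult_left_mono) auto
    moreover have "0 \<le> a * p (n + 1) + b * p n" using a b p0 by simp
    ultimately show ?thesis unfolding p_def[of "n + 3"] by simp
  qed
  have Pmono: "P m \<le> P n" if "m \<le> n" for m n
    unfolding P_def using p0 that by (intro sum_mono2) auto
  have P0: "P n \<ge> 0" for n unfolding P_def using p0 by (intro sum_nonneg) auto
  have bound: "P (n + 3) \<le> P 3 + a * P (n + 1) + b * P n" for n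
  proof (induction n)
    case 0
    show ?case using a b P0[of 0] P0[of 1] by simp
  next
    case (Suc n)
    have "P (Suc m) = P m + p m" for m by (simp add: P_def)
    from this[of "n + 3"] this[of "n + 1"] this[of n] show ?case
      using Suc step[of n] by (simp add: algebra_simps)
  qed
  have all: "P n \<le> 8 / 3 * P 3" for n
  proof -
    have "a * P (n + 1) + b * P n \<le> a * P (n + 3) + b * P (n + 3)"
      using a b Pmono by (intro add_mono mult_left_mono) auto
    also have "\<dots> = (a + b) * P (n + 3)" by (simp add: algebra_simps)
    also have "\<dots> \<le> 5 / 8 * P (n + 3)" using ab P0 by (rule mult_right_mono)
    finally have "P (n + 3) \<le> 8 / 3 * P 3" using bound[of n] by simp
    then show ?thesis using Pmono[of n "n + 3"] by simp
  qed
  obtain m where m: "A \<subseteq> {..<m}"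
    using fin finite_nat_iff_bounded by blast
  have "sum e A \<le> sum p A" using ep by (rule sum_mono)
  also have "\<dots> \<le> P m" unfolding P_def using m p0 by (intro sum_mono2) auto
  also have "\<dots> \<le> 8 / 3 * P 3" by (rule all)
  finally show ?thesis by (simp add: P_def p_def numeral_eq_Suc)
qed

lemma trib_err_coeffs: "0 \<le> 2 - \<tau>" "0 \<le> 2 + \<tau> - \<tau>\<^sup>2" "(2 - \<tau>) + (2 + \<tau> - \<tau>\<^sup>2) \<le> 5 / 8"
  using tribonacci_const_bounds tribonacci_const_square_bounds by simp_all

lemma trib_err_init:
  "trib_err 0 \<le> 0" "trib_err 1 \<le> 0" "0 \<le> trib_err 2" "trib_err 2 \<le> 3 / 16"
  "- (3 / 8) \<le> trib_err 0 + trib_err 1"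
proof -
  let ?c = "trib_C1 * \<tau> ^ 3"
  note b = trib_C1_cube_bounds tribonacci_const_bounds tribonacci_const_square_bounds
  have 1: "113 / 100 * (1839 / 1000) \<le> ?c * \<tau>" using b by (intro mult_mono) auto
  have 2: "113 / 100 * (3381 / 1000) \<le> ?c * \<tau>\<^sup>2" using b by (intro mult_mono) auto
  have 3: "?c * \<tau> \<le> 115 / 100 * (184 / 100)" using b by (intro mult_mono) auto
  have 4: "?c * \<tau>\<^sup>2 \<le> 115 / 100 * (3386 / 1000)" using b by (intro mult_mono) auto
  have T: "trib_err 0 = 1 - ?c" "trib_err 1 = 2 - ?c * \<tau>" "trib_err 2 = 4 - ?c * \<tau>\<^sup>2"
    by (simp_all add: trib_err_def numeral_2_eq_2)
  show "trib_err 0 \<le> 0" "trib_err 1 \<le> 0" "0 \<le> trib_err 2" "trib_err 2 \<le> 3 / 16"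
    "- (3 / 8) \<le> trib_err 0 + trib_err 1"
    unfolding T using 1 2 3 4 b by simp_all
qed

lemma sum_trib_err_le: "finite A \<Longrightarrow> sum trib_err A \<le> 1 / 2"
  using contracting_sum_le[OF trib_err_rec3 trib_err_coeffs, of A] trib_err_init by simp

lemma sum_trib_err_ge:
  assumes "finite A"
  shows "sum trib_err A \<ge> - 1"
proof -
  have "- trib_err (n + 3) = (2 - \<tau>) * - trib_err (n + 1) + (2 + \<tau> - \<tau>\<^sup>2) * - trib_err n" for n
    using trib_err_rec3[of n] by simp
  from contracting_sum_le[of "\<lambda>n. - trib_err n", OF this trib_err_coeffs assms]
  show ?thesis using trib_err_init by (simp add: sum_negf)
qed

lemma sum_trib_eq: "real (sum trib A) = trib_C1 * \<tau> ^ 3 * spectrum_val A + sum trib_err A"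
  by (simp add: trib_err_def spectrum_val_def sum_subtractf sum_distrib_left)

section \<open>Gaps of the spectrum\<close>

lemma spectrum_val_gap:
  assumes "triple_free A" "triple_free B" "spectrum_val A < spectrum_val B"
  shows "spectrum_val B - spectrum_val A \<ge> \<tau>\<^sup>2 - \<tau> - 1"
proof -
  obtain m where "leads_at B A m"
    using assms trib_pow.sum_less_imp_leads_at unfolding spectrum_val_def by blast
  from trib_pow.leads_at_sum_gap[OF triple_free_finite[OF assms(2)] assms(1) this]
  show ?thesis by (simp add: spectrum_val_def)
qed

text \<open>A triple-free set below \<open>m\<close> that avoids \<open>0\<close> is a shift, so its shortfall is \<open>\<tau>\<close> times that of a
  triple-free set below \<open>m - 1\<close>, that is, at least \<open>\<tau> * (1/\<tau>)\<close>.\<close>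
lemma spectrum_val_gap_no_zero:
  assumes "triple_free A" "triple_free B" "spectrum_val A < spectrum_val B" "0 \<notin> A"
  shows "spectrum_val B - spectrum_val A \<ge> 1"
proof -
  obtain m where m: "leads_at B A m"
    using assms trib_pow.sum_less_imp_leads_at unfolding spectrum_val_def by blast
  let ?A = "A \<inter> {..<m}"
  have "(\<Sum>i\<in>?A. \<tau> ^ i) + 1 \<le> \<tau> ^ m"
  proof (cases m)
    case 0
    then show ?thesis by simp
  next
    case (Suc j)
    define B' where "B' = {i. Suc i \<in> ?A}"
    have img: "?A = Suc ` B'"
      using assms(4) unfolding B'_def by (auto simp: image_iff) (metis Suc_pred' gr0I)
    have "finite B'" using assms(1) triple_free_finite img
      by (metis finite_Int finite_imageD inj_Suc inj_on_subset subset_UNIV)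
    moreover have "\<not> (h \<in> B' \<and> h + 1 \<in> B' \<and> h + 2 \<in> B')" for h
      using assms(1) unfolding triple_free_def B'_def by (auto dest: spec[of _ "Suc h"])
    ultimately have "triple_free B'" unfolding triple_free_def by blast
    moreover have "B' \<subseteq> {..<j}" unfolding B'_def Suc by auto
    ultimately have "(\<Sum>i\<in>B'. \<tau> ^ i) + (\<tau>\<^sup>2 - \<tau> - 1) \<le> \<tau> ^ j" by (rule trib_pow.sum_below)
    then have "\<tau> * ((\<Sum>i\<in>B'. \<tau> ^ i) + (\<tau>\<^sup>2 - \<tau> - 1)) \<le> \<tau> * \<tau> ^ j"
      using tribonacci_const_gt_1 by (intro mult_left_mono) auto
    moreover have "(\<Sum>i\<in>?A. \<tau> ^ i) = \<tau> * (\<Sum>i\<in>B'. \<tau> ^ i)"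
      unfolding img by (simp add: sum.reindex sum_distrib_left)
    ultimately show ?thesis unfolding distrib_left tribonacci_const_inverse Suc by simp
  qed
  with trib_pow.sum_diff_ge_leading[OF triple_free_finite[OF assms(2)] triple_free_finite[OF assms(1)] m]
  show ?thesis by (simp add: spectrum_val_def)
qed

lemma spectrum_val_gap_both_zero:
  assumes "triple_free A" "triple_free B" "spectrum_val A < spectrum_val B" "0 \<in> A" "0 \<in> B"
  shows "spectrum_val B - spectrum_val A \<ge> 1"
proof -
  have rem: "spectrum_val C = 1 + spectrum_val (C - {0})" if "triple_free C" "0 \<in> C" for C
    using sum.remove[OF triple_free_finite[OF that(1)] that(2), of "\<lambda>i. \<tau> ^ i"]
    by (simp add: spectrum_val_def)
  have "triple_free (A - {0})" "triple_free (B - {0})"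
    using assms triple_free_subset by blast+
  then show ?thesis
    using spectrum_val_gap_no_zero[of "A - {0}" "B - {0}"] rem assms by simp
qed

lemma spectrum_two_gaps: "spectrum_listing \<tau> (k + 2) - spectrum_listing \<tau> k \<ge> \<tau>\<^sup>2 - \<tau>"
proof -
  obtain A where A: "triple_free A" "sum trib A = k" using ex_triple_free_sum_trib by blast
  obtain B where B: "triple_free B" "sum trib B = k + 1" using ex_triple_free_sum_trib by blast
  obtain C where C: "triple_free C" "sum trib C = k + 2" using ex_triple_free_sum_trib by blast
  have lam: "spectrum_listing \<tau> k = spectrum_val A" "spectrum_listing \<tau> (k + 2) = spectrum_val C"
    using spectrum_listing_tribonacci A C by metis+
  have AB: "spectrum_val A < spectrum_val B" and BC: "spectrum_val B < spectrum_val C"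
    using spectrum_val_less_iff A B C by simp_all
  note gaps = spectrum_val_gap[OF A(1) B(1) AB] spectrum_val_gap[OF B(1) C(1) BC]
  consider "0 \<notin> A" | "0 \<notin> B" | "0 \<in> A" "0 \<in> B" by blast
  then show ?thesis unfolding lam
  proof cases
    case 1
    then show "spectrum_val C - spectrum_val A \<ge> \<tau>\<^sup>2 - \<tau>"
      using spectrum_val_gap_no_zero[OF A(1) B(1) AB] gaps by simp
  next
    case 2
    then show "spectrum_val C - spectrum_val A \<ge> \<tau>\<^sup>2 - \<tau>"
      using spectrum_val_gap_no_zero[OF B(1) C(1) BC] gaps by simp
  next
    case 3
    then show "spectrum_val C - spectrum_val A \<ge> \<tau>\<^sup>2 - \<tau>"
      using spectrum_val_gap_both_zero[OF A(1) B(1) AB] gaps by simp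
  qed
qed

section \<open>The gap estimates\<close>

text \<open>Multiplied by \<open>C\<^sub>1 \<tau> ^ 3\<close>, the defect from additivity is a combination of three error sums, which is at
  least \<open>- 1 - 1 - 1/2\<close>; and \<open>5/2\<close> is smaller than \<open>2 * (\<tau>\<^sup>2 - 1)\<close>.\<close>
lemma spectrum_listing_almost_superadditive:
  "spectrum_listing \<tau> (N + k) - spectrum_listing \<tau> k
    \<ge> spectrum_listing \<tau> N - 2 * (\<tau>\<^sup>2 - 1)"
proof -
  let ?c = "trib_C1 * \<tau> ^ 3"
  obtain A where A: "triple_free A" "sum trib A = N" using ex_triple_free_sum_trib by blast
  obtain B where B: "triple_free B" "sum trib B = k" using ex_triple_free_sum_trib by blast
  obtain C where C: "triple_free C" "sum trib C = N + k" using ex_triple_free_sum_trib by blast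
  have lam: "spectrum_listing \<tau> N = spectrum_val A" "spectrum_listing \<tau> k = spectrum_val B"
    "spectrum_listing \<tau> (N + k) = spectrum_val C"
    using spectrum_listing_tribonacci A B C by metis+
  have "real N = ?c * spectrum_val A + sum trib_err A" "real k = ?c * spectrum_val B + sum trib_err B"
    "real N + real k = ?c * spectrum_val C + sum trib_err C"
    using sum_trib_eq[of A] sum_trib_eq[of B] sum_trib_eq[of C] A B C by simp_all
  then have "?c * (spectrum_val C - spectrum_val B - spectrum_val A)
      = sum trib_err A + sum trib_err B - sum trib_err C"
    by (simp add: algebra_simps)
  also have "\<dots> \<ge> - 5 / 2"
    using sum_trib_err_ge[of A] sum_trib_err_ge[of B] sum_trib_err_le[of C] A B C triple_free_finite
    by simp
  finally have ge: "- 5 / 2 \<le> ?c * (spectrum_val C - spectrum_val B - spectrum_val A)" .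
  have "- 5 / 2 \<le> D" if "- 5 / 2 \<le> ?c * D" for D
  proof (cases "D \<ge> 0")
    case False
    then have "?c * D \<le> 1 * D"
      using trib_C1_cube_bounds by (intro mult_right_mono_neg) auto
    with that show ?thesis unfolding mult_1_left by (rule order_trans)
  qed simp
  from this[OF ge] have "- 5 / 2 \<le> spectrum_val C - spectrum_val B - spectrum_val A" .
  then show ?thesis unfolding lam using tribonacci_const_square_bounds by simp
qed

theorem corollary3p2:
  fixes \<tau> :: real and lam :: "nat \<Rightarrow> real" and N :: nat and x :: "nat \<Rightarrow> nat"
  defines "\<tau> \<equiv> tribonacci_const"
    and "lam \<equiv> spectrum_listing \<tau>"
  assumes "N \<ge> 1" and "canonical_trib_expansion x N"
  shows "(\<forall>k\<ge>1. lam (N + k) - lam k \<ge> real N * gamma3 x N) \<and>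
    gamma3 x N \<ge> 1 / (trib_C1 * \<tau> ^ 3)
      - 1 / real N * (1 / (2 * trib_C1 * \<tau> ^ 3) * log \<tau> ((real N + 1 / 2) / trib_C1)
          + 2 * \<tau>\<^sup>2 - 2 - 1 / (trib_C1 * \<tau> ^ 3)) \<and>
    (\<forall>k\<ge>1. lam (2 + k) - lam k \<ge> 2 * ((\<tau>\<^sup>2 - \<tau>) / 2))"
proof -
  let ?A = "{h. x h \<noteq> 0}"
  note A = canonical_trib_expansionD[OF assms(4), folded \<tau>_def]
  have N: "real N > 0" using assms(3) by simp
  have lamN: "lam N = spectrum_val ?A"
    unfolding lam_def \<tau>_def using spectrum_listing_tribonacci[OF A(1)] A(2) by simp
  have gamma: "real N * gamma3 x N = lam N - 2 * (\<tau>\<^sup>2 - 1)"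
    unfolding gamma3_def lamN A(3)[symmetric] \<tau>_def[symmetric] using N by simp
  have first: "lam (N + k) - lam k \<ge> real N * gamma3 x N" for k
    unfolding gamma unfolding lam_def \<tau>_def by (rule spectrum_listing_almost_superadditive)

  define c where "c = trib_C1 * \<tau> ^ 3"
  have c: "113 / 100 \<le> c" "c \<le> 115 / 100"
    unfolding c_def \<tau>_def by (rule trib_C1_cube_bounds)+
  have \<tau>: "\<tau> > 1" unfolding \<tau>_def by (rule tribonacci_const_gt_1)
  have C1: "trib_C1 > 0"
    unfolding trib_C1_def using trib_C1_denominator_pos by simp
  define L where "L = log \<tau> ((real N + 1 / 2) / trib_C1)"
  have "L \<ge> 3"
  proof -
    have "\<tau> ^ 3 * trib_C1 \<le> real N + 1 / 2" using c(2) assms(3) by (simp add: c_def mult.commute)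
    then have "\<tau> ^ 3 \<le> (real N + 1 / 2) / trib_C1" using C1 by (simp add: pos_le_divide_eq)
    then have "log \<tau> (\<tau> ^ 3) \<le> L" unfolding L_def using \<tau> by (intro log_mono) auto
    then show ?thesis using \<tau> by (simp add: log_nat_power)
  qed
  have "real N = c * lam N + sum trib_err ?A"
    using sum_trib_eq[of ?A] A(2) unfolding lamN c_def \<tau>_def by simp
  moreover have "sum trib_err ?A \<le> 1 / 2" using A(1) triple_free_finite sum_trib_err_le by blast
  ultimately have "c * lam N \<ge> real N - (L / 2 - 1)" using \<open>L \<ge> 3\<close> by simp
  then have "lam N \<ge> (real N - (L / 2 - 1)) / c" using c(1) by (simp add: pos_divide_le_eq mult.commute)
  then have "real N * gamma3 x N \<ge> (real N - (L / 2 - 1)) / c - 2 * (\<tau>\<^sup>2 - 1)" unfolding gamma by simp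
  then have "gamma3 x N \<ge> ((real N - (L / 2 - 1)) / c - 2 * (\<tau>\<^sup>2 - 1)) / real N"
    using N by (simp add: pos_divide_le_eq mult.commute)
  also have "((real N - (L / 2 - 1)) / c - 2 * (\<tau>\<^sup>2 - 1)) / real N
      = 1 / c - 1 / real N * (1 / (2 * c) * L + 2 * \<tau>\<^sup>2 - 2 - 1 / c)"
  proof -
    have "(real N - (L / 2 - 1)) / c = real N * (1 / c) - (1 / (2 * c) * L - 1 / c)"
      by (simp add: diff_divide_distrib)
    then show ?thesis using N by (simp add: diff_divide_distrib add_divide_distrib)
  qed
  finally have second: "gamma3 x N \<ge> 1 / (trib_C1 * \<tau> ^ 3)
      - 1 / real N * (1 / (2 * trib_C1 * \<tau> ^ 3) * log \<tau> ((real N + 1 / 2) / trib_C1)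
          + 2 * \<tau>\<^sup>2 - 2 - 1 / (trib_C1 * \<tau> ^ 3))"
    by (simp add: c_def L_def mult.assoc)

  have "lam (2 + k) - lam k \<ge> 2 * ((\<tau>\<^sup>2 - \<tau>) / 2)" for k
    using spectrum_two_gaps[of k] unfolding lam_def \<tau>_def by (simp add: add.commute)
  then show ?thesis using first second by blast
qed

end
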